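(* Let $C$ be a coassociative coalgebra over a field $\mathbb{K}$ (not necessarily with counit). Then the subcoalgebra of $C$ generated by an element $c\in C$ is finite dimensional.
   Context: A coalgebra $(C,\delta)$ is a vector space with a coassociative linear map $\delta:C\to C\otimes C$; no counit is required. A subcoalgebra is a subspace $D$ with $\delta(D)\subseteq D\otimes D$. The subcoalgebra generated by $c$ is the smallest subcoalgebra of $C$ containing $c$. *)

theory Defs
  imports "HOL.Vector_Spaces" "HOL-Library.Poly_Mapping"
begin

section \<open>Free vector spaces and their quotients\<close>

text \<open>The type \<open>'i \<Rightarrow>\<^sub>0 'k\<close> of finitely supported functions is the free vector space on
  the type \<open>'i\<close>; its canonical basis vectors are the \<open>free_gen i\<close>.\<close>

definition free_scale :: "'k::field \<Rightarrow> ('i \<Rightarrow>\<^sub>0 'k) \<Rightarrow> ('i \<Rightarrow>\<^sub>0 'k)" where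
  "free_scale k u = Poly_Mapping.map ((*) k) u"

definition free_gen :: "'i \<Rightarrow> ('i \<Rightarrow>\<^sub>0 'k::field)" where
  "free_gen i = Poly_Mapping.single i 1"

lemma lookup_free_scale [simp]:
  "Poly_Mapping.lookup (free_scale k u) i = k * Poly_Mapping.lookup u i"
  by (simp add: free_scale_def Poly_Mapping.map.rep_eq when_def)

global_interpretation free: vector_space "free_scale :: 'k::field \<Rightarrow> ('i \<Rightarrow>\<^sub>0 'k) \<Rightarrow> ('i \<Rightarrow>\<^sub>0 'k)"
  by unfold_locales (auto intro!: poly_mapping_eqI simp: lookup_add algebra_simps)

text \<open>The quotient of a free vector space by a subspace \<open>N\<close> is the set
  \<open>range (coset N)\<close> with the operations \<open>coset_add\<close> and \<open>coset_scale N\<close>.\<close>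

definition coset :: "('i \<Rightarrow>\<^sub>0 'k::field) set \<Rightarrow> ('i \<Rightarrow>\<^sub>0 'k) \<Rightarrow> ('i \<Rightarrow>\<^sub>0 'k) set" where
  "coset N u = {u + n | n. n \<in> N}"

definition coset_add :: "('i \<Rightarrow>\<^sub>0 'k::field) set \<Rightarrow> ('i \<Rightarrow>\<^sub>0 'k) set \<Rightarrow> ('i \<Rightarrow>\<^sub>0 'k) set" where
  "coset_add X Y = {u + v | u v. u \<in> X \<and> v \<in> Y}"

definition coset_scale ::
  "('i \<Rightarrow>\<^sub>0 'k::field) set \<Rightarrow> 'k \<Rightarrow> ('i \<Rightarrow>\<^sub>0 'k) set \<Rightarrow> ('i \<Rightarrow>\<^sub>0 'k) set" where
  "coset_scale N k X = {free_scale k u + n | u n. u \<in> X \<and> n \<in> N}"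

definition coset_rep :: "('i \<Rightarrow>\<^sub>0 'k::field) set \<Rightarrow> ('i \<Rightarrow>\<^sub>0 'k)" where
  "coset_rep X = (SOME u. u \<in> X)"

lemma mem_coset_iff: "w \<in> coset N u \<longleftrightarrow> w - u \<in> N"
proof
  assume "w - u \<in> N"
  moreover have "w = u + (w - u)" by simp
  ultimately show "w \<in> coset N u" unfolding coset_def by blast
qed (auto simp: coset_def)

lemma coset_self:
  assumes "free.subspace N"
  shows "u \<in> coset N u"
  using free.subspace_0[OF assms] by (simp add: mem_coset_iff)

lemma coset_eq_iff:
  assumes "free.subspace N"
  shows "coset N u = coset N v \<longleftrightarrow> u - v \<in> N"
proof
  assume "coset N u = coset N v"
  with coset_self[OF assms, of u] show "u - v \<in> N" by (simp add: mem_coset_iff)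
next
  assume d: "u - v \<in> N"
  show "coset N u = coset N v"
  proof (rule set_eqI)
    fix w
    show "w \<in> coset N u \<longleftrightarrow> w \<in> coset N v"
      using free.subspace_add[OF assms _ d, of "w - u"] free.subspace_diff[OF assms _ d, of "w - v"]
      by (auto simp: mem_coset_iff)
  qed
qed

lemma coset_add_coset:
  assumes "free.subspace N"
  shows "coset_add (coset N u) (coset N v) = coset N (u + v)"
proof (intro set_eqI iffI)
  fix w assume "w \<in> coset_add (coset N u) (coset N v)"
  then obtain a b where w: "w = a + b" and ab: "a - u \<in> N" "b - v \<in> N"
    unfolding coset_add_def mem_coset_iff by blast
  have "w - (u + v) = (a - u) + (b - v)" by (simp add: w algebra_simps)
  with free.subspace_add[OF assms ab] show "w \<in> coset N (u + v)"
    by (simp only: mem_coset_iff)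
next
  fix w assume "w \<in> coset N (u + v)"
  hence "w - v \<in> coset N u" by (simp add: mem_coset_iff algebra_simps)
  moreover have "w = (w - v) + v" by simp
  ultimately show "w \<in> coset_add (coset N u) (coset N v)"
    using coset_self[OF assms, of v] unfolding coset_add_def by blast
qed

lemma coset_scale_coset:
  assumes "free.subspace N"
  shows "coset_scale N k (coset N u) = coset N (free_scale k u)"
proof (intro set_eqI iffI)
  fix w assume "w \<in> coset_scale N k (coset N u)"
  then obtain a n where w: "w = free_scale k a + n" and a: "a - u \<in> N" and n: "n \<in> N"
    unfolding coset_scale_def mem_coset_iff by blast
  have "w - free_scale k u = free_scale k (a - u) + n"
    by (simp add: w free.scale_right_diff_distrib algebra_simps)
  with free.subspace_add[OF assms free.subspace_scale[OF assms a] n]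
  show "w \<in> coset N (free_scale k u)" by (simp only: mem_coset_iff)
next
  fix w assume "w \<in> coset N (free_scale k u)"
  then obtain n where "w = free_scale k u + n" "n \<in> N" unfolding coset_def by blast
  with coset_self[OF assms, of u] show "w \<in> coset_scale N k (coset N u)"
    unfolding coset_scale_def by blast
qed

lemma coset_coset_rep:
  assumes "free.subspace N" "X \<in> range (coset N)"
  shows "coset N (coset_rep X) = X"
proof -
  obtain u where X: "X = coset N u" using assms(2) by blast
  have "coset_rep X \<in> X"
    unfolding coset_rep_def X using coset_self[OF assms(1)] by (rule someI)
  thus ?thesis by (simp add: X coset_eq_iff[OF assms(1)] mem_coset_iff)
qed


section \<open>Tensor powers of a vector space\<close>

context vector_space
begin

text \<open>\<open>V \<otimes> V\<close> and \<open>V \<otimes> V \<otimes> V\<close> are the quotients of the free vector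
  spaces on \<open>V \<times> V\<close> and \<open>V \<times> V \<times> V\<close> by the bilinear and the trilinear relations.\<close>

definition tensor2_null :: "('b \<times> 'b \<Rightarrow>\<^sub>0 'a) set" where
  "tensor2_null = free.span
    ({free_gen (x + x', y) - free_gen (x, y) - free_gen (x', y) | x x' y. True}
   \<union> {free_gen (x, y + y') - free_gen (x, y) - free_gen (x, y') | x y y'. True}
   \<union> {free_gen (scale k x, y) - free_scale k (free_gen (x, y)) | k x y. True}
   \<union> {free_gen (x, scale k y) - free_scale k (free_gen (x, y)) | k x y. True})"

definition tensor3_null :: "('b \<times> 'b \<times> 'b \<Rightarrow>\<^sub>0 'a) set" where
  "tensor3_null = free.span
    ({free_gen (x + x', y, z) - free_gen (x, y, z) - free_gen (x', y, z) | x x' y z. True}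
   \<union> {free_gen (x, y + y', z) - free_gen (x, y, z) - free_gen (x, y', z) | x y y' z. True}
   \<union> {free_gen (x, y, z + z') - free_gen (x, y, z) - free_gen (x, y, z') | x y z z'. True}
   \<union> {free_gen (scale k x, y, z) - free_scale k (free_gen (x, y, z)) | k x y z. True}
   \<union> {free_gen (x, scale k y, z) - free_scale k (free_gen (x, y, z)) | k x y z. True}
   \<union> {free_gen (x, y, scale k z) - free_scale k (free_gen (x, y, z)) | k x y z. True})"

definition tensor2_space :: "('b \<times> 'b \<Rightarrow>\<^sub>0 'a) set set" where
  "tensor2_space = range (coset tensor2_null)"

definition tensor3_space :: "('b \<times> 'b \<times> 'b \<Rightarrow>\<^sub>0 'a) set set" where
  "tensor3_space = range (coset tensor3_null)"

definition tensor2 :: "'b \<Rightarrow> 'b \<Rightarrow> ('b \<times> 'b \<Rightarrow>\<^sub>0 'a) set" where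
  "tensor2 x y = coset tensor2_null (free_gen (x, y))"

definition tensor3 :: "'b \<Rightarrow> 'b \<Rightarrow> 'b \<Rightarrow> ('b \<times> 'b \<times> 'b \<Rightarrow>\<^sub>0 'a) set" where
  "tensor3 x y z = coset tensor3_null (free_gen (x, y, z))"

text \<open>For a subspace \<open>D\<close> of \<open>V\<close>, the image of \<open>D \<otimes> D\<close> in \<open>V \<otimes> V\<close>; as we are over a
  field, the map \<open>D \<otimes> D \<rightarrow> V \<otimes> V\<close> is injective.\<close>

definition tensor2_sub :: "'b set \<Rightarrow> ('b \<times> 'b \<Rightarrow>\<^sub>0 'a) set set" where
  "tensor2_sub D = coset tensor2_null ` {u. Poly_Mapping.keys u \<subseteq> D \<times> D}"

definition linear_to_tensor2 :: "('b \<Rightarrow> ('b \<times> 'b \<Rightarrow>\<^sub>0 'a) set) \<Rightarrow> bool" where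
  "linear_to_tensor2 f \<longleftrightarrow>
     (\<forall>x. f x \<in> tensor2_space) \<and>
     (\<forall>x y. f (x + y) = coset_add (f x) (f y)) \<and>
     (\<forall>k x. f (scale k x) = coset_scale tensor2_null k (f x))"

definition bilinear_to_tensor3 :: "('b \<Rightarrow> 'b \<Rightarrow> ('b \<times> 'b \<times> 'b \<Rightarrow>\<^sub>0 'a) set) \<Rightarrow> bool" where
  "bilinear_to_tensor3 \<beta> \<longleftrightarrow>
     (\<forall>x y. \<beta> x y \<in> tensor3_space) \<and>
     (\<forall>x x' y. \<beta> (x + x') y = coset_add (\<beta> x y) (\<beta> x' y)) \<and>
     (\<forall>x y y'. \<beta> x (y + y') = coset_add (\<beta> x y) (\<beta> x y')) \<and>
     (\<forall>k x y. \<beta> (scale k x) y = coset_scale tensor3_null k (\<beta> x y)) \<and>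
     (\<forall>k x y. \<beta> x (scale k y) = coset_scale tensor3_null k (\<beta> x y))"

text \<open>The linear map \<open>V \<otimes> V \<rightarrow> V \<otimes> V \<otimes> V\<close> induced by a bilinear map \<open>\<beta>\<close>, sending
  \<open>\<Sum>\<^sub>i k\<^sub>i (x\<^sub>i \<otimes> y\<^sub>i)\<close> to \<open>\<Sum>\<^sub>i k\<^sub>i \<beta> x\<^sub>i y\<^sub>i\<close>. The choice of representatives is
  immaterial, see \<open>tensor2_lift_coset\<close> below.\<close>

definition tensor2_lift ::
  "('b \<Rightarrow> 'b \<Rightarrow> ('b \<times> 'b \<times> 'b \<Rightarrow>\<^sub>0 'a) set) \<Rightarrow> ('b \<times> 'b \<Rightarrow>\<^sub>0 'a) set
     \<Rightarrow> ('b \<times> 'b \<times> 'b \<Rightarrow>\<^sub>0 'a) set" where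
  "tensor2_lift \<beta> X = coset tensor3_null
     (\<Sum>(x, y) \<in> Poly_Mapping.keys (coset_rep X).
        free_scale (Poly_Mapping.lookup (coset_rep X) (x, y)) (coset_rep (\<beta> x y)))"

text \<open>For \<open>X \<in> V \<otimes> V\<close> and \<open>z \<in> V\<close>, the elements \<open>X \<otimes> z\<close> and \<open>z \<otimes> X\<close> of \<open>V \<otimes> V \<otimes> V\<close>.\<close>

definition tensor_right :: "('b \<times> 'b \<Rightarrow>\<^sub>0 'a) set \<Rightarrow> 'b \<Rightarrow> ('b \<times> 'b \<times> 'b \<Rightarrow>\<^sub>0 'a) set" where
  "tensor_right X z = tensor2_lift (\<lambda>x y. tensor3 x y z) X"

definition tensor_left :: "'b \<Rightarrow> ('b \<times> 'b \<Rightarrow>\<^sub>0 'a) set \<Rightarrow> ('b \<times> 'b \<times> 'b \<Rightarrow>\<^sub>0 'a) set" where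
  "tensor_left z X = tensor2_lift (\<lambda>x y. tensor3 z x y) X"

text \<open>The maps \<open>f \<otimes> id\<close> and \<open>id \<otimes> f\<close> for a linear map \<open>f: V \<rightarrow> V \<otimes> V\<close>, where
  \<open>(V \<otimes> V) \<otimes> V\<close> and \<open>V \<otimes> (V \<otimes> V)\<close> are both identified with \<open>V \<otimes> V \<otimes> V\<close>.\<close>

definition map_tensor_id ::
  "('b \<Rightarrow> ('b \<times> 'b \<Rightarrow>\<^sub>0 'a) set) \<Rightarrow> ('b \<times> 'b \<Rightarrow>\<^sub>0 'a) set \<Rightarrow> ('b \<times> 'b \<times> 'b \<Rightarrow>\<^sub>0 'a) set" where
  "map_tensor_id f = tensor2_lift (\<lambda>x y. tensor_right (f x) y)"

definition id_tensor_map ::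
  "('b \<Rightarrow> ('b \<times> 'b \<Rightarrow>\<^sub>0 'a) set) \<Rightarrow> ('b \<times> 'b \<Rightarrow>\<^sub>0 'a) set \<Rightarrow> ('b \<times> 'b \<times> 'b \<Rightarrow>\<^sub>0 'a) set" where
  "id_tensor_map f = tensor2_lift (\<lambda>x y. tensor_left x (f y))"

definition finite_dimensional :: "'b set \<Rightarrow> bool" where
  "finite_dimensional D \<longleftrightarrow> (\<exists>B. finite B \<and> span B = D)"

lemma subspace_tensor2_null: "free.subspace tensor2_null"
  by (simp add: tensor2_null_def)

lemma subspace_tensor3_null: "free.subspace tensor3_null"
  by (simp add: tensor3_null_def)

end


subsection \<open>Well-definedness of the induced maps\<close>

definition free_ext :: "('i \<Rightarrow> ('j \<Rightarrow>\<^sub>0 'k)) \<Rightarrow> ('i \<Rightarrow>\<^sub>0 'k::field) \<Rightarrow> ('j \<Rightarrow>\<^sub>0 'k)" where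
  "free_ext g u = (\<Sum>i\<in>Poly_Mapping.keys u. free_scale (Poly_Mapping.lookup u i) (g i))"

lemma free_ext_superset:
  assumes "finite S" "Poly_Mapping.keys u \<subseteq> S"
  shows "free_ext g u = (\<Sum>i\<in>S. free_scale (Poly_Mapping.lookup u i) (g i))"
  unfolding free_ext_def using assms
  by (intro sum.mono_neutral_left) (auto simp: in_keys_iff)

lemma linear_free_ext:
  fixes g :: "'i \<Rightarrow> ('j \<Rightarrow>\<^sub>0 'k::field)"
  shows "Vector_Spaces.linear free_scale free_scale (free_ext g)"
proof unfold_locales
  fix u v :: "'i \<Rightarrow>\<^sub>0 'k" and k :: 'k
  let ?S = "Poly_Mapping.keys u \<union> Poly_Mapping.keys v"
  show "free_ext g (u + v) = free_ext g u + free_ext g v"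
    using keys_add[of u v]
    by (simp add: free_ext_superset[of ?S] lookup_add free.scale_left_distrib sum.distrib)
  have "Poly_Mapping.keys (free_scale k u) \<subseteq> Poly_Mapping.keys u"
    by (auto simp: in_keys_iff)
  thus "free_ext g (free_scale k u) = free_scale k (free_ext g u)"
    by (simp add: free_ext_superset[of "Poly_Mapping.keys u"] free.scale_sum_right)
qed

lemma free_ext_gen [simp]: "free_ext g (free_gen i) = g i"
  by (simp add: free_ext_def free_gen_def)

context vector_space
begin

lemma tensor2_lift_eq:
  "tensor2_lift \<beta> X = coset tensor3_null (free_ext (\<lambda>(x, y). coset_rep (\<beta> x y)) (coset_rep X))"
  by (simp add: tensor2_lift_def free_ext_def case_prod_beta)

lemma free_ext_tensor2_null:
  assumes "bilinear_to_tensor3 \<beta>" "u \<in> tensor2_null"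
  shows "free_ext (\<lambda>(x, y). coset_rep (\<beta> x y)) u \<in> tensor3_null"
proof -
  let ?F = "free_ext (\<lambda>(x, y). coset_rep (\<beta> x y))"
  interpret F: Vector_Spaces.linear free_scale free_scale ?F by (rule linear_free_ext)
  note N3 = subspace_tensor3_null
  have b: "\<beta> x y \<in> range (coset tensor3_null)"
    "\<beta> (x + x') y = coset_add (\<beta> x y) (\<beta> x' y)"
    "\<beta> x (y + y') = coset_add (\<beta> x y) (\<beta> x y')"
    "\<beta> (scale k x) y = coset_scale tensor3_null k (\<beta> x y)"
    "\<beta> x (scale k y) = coset_scale tensor3_null k (\<beta> x y)" for x x' y y' k
    using assms(1) by (simp_all add: bilinear_to_tensor3_def tensor3_space_def)
  note r = coset_coset_rep[OF N3 b(1)]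
  have a1: "coset_rep (\<beta> (x + x') y) - coset_rep (\<beta> x y) - coset_rep (\<beta> x' y) \<in> tensor3_null" for x x' y
    unfolding diff_diff_eq coset_eq_iff[OF N3, symmetric] coset_add_coset[OF N3, symmetric] r by (rule b)
  have a2: "coset_rep (\<beta> x (y + y')) - coset_rep (\<beta> x y) - coset_rep (\<beta> x y') \<in> tensor3_null" for x y y'
    unfolding diff_diff_eq coset_eq_iff[OF N3, symmetric] coset_add_coset[OF N3, symmetric] r by (rule b)
  have s1: "coset_rep (\<beta> (scale k x) y) - free_scale k (coset_rep (\<beta> x y)) \<in> tensor3_null" for k x y
    unfolding coset_eq_iff[OF N3, symmetric] coset_scale_coset[OF N3, symmetric] r by (rule b)
  have s2: "coset_rep (\<beta> x (scale k y)) - free_scale k (coset_rep (\<beta> x y)) \<in> tensor3_null" for k x y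
    unfolding coset_eq_iff[OF N3, symmetric] coset_scale_coset[OF N3, symmetric] r by (rule b)
  have "free.subspace {u. ?F u \<in> tensor3_null}"
    using free.subspace_0[OF N3] free.subspace_add[OF N3] free.subspace_scale[OF N3]
    by (simp add: free.subspace_def F.add F.scale F.zero)
  hence "tensor2_null \<subseteq> {u. ?F u \<in> tensor3_null}"
    unfolding tensor2_null_def
    by (intro free.span_minimal)
       (auto simp: F.diff F.scale a1 a2 s1 s2)
  from subsetD[OF this assms(2)] show ?thesis by simp
qed

lemma tensor2_lift_coset:
  assumes "bilinear_to_tensor3 \<beta>"
  shows "tensor2_lift \<beta> (coset tensor2_null u)
    = coset tensor3_null (free_ext (\<lambda>(x, y). coset_rep (\<beta> x y)) u)"
proof -
  let ?F = "free_ext (\<lambda>(x, y). coset_rep (\<beta> x y))"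
  interpret F: Vector_Spaces.linear free_scale free_scale ?F by (rule linear_free_ext)
  have "coset tensor2_null (coset_rep (coset tensor2_null u)) = coset tensor2_null u"
    by (rule coset_coset_rep[OF subspace_tensor2_null]) simp
  hence "coset_rep (coset tensor2_null u) - u \<in> tensor2_null"
    using coset_eq_iff[OF subspace_tensor2_null] by blast
  from free_ext_tensor2_null[OF assms this] show ?thesis
    by (simp add: tensor2_lift_eq coset_eq_iff[OF subspace_tensor3_null] F.diff)
qed

lemma tensor2_lift_tensor2:
  assumes "bilinear_to_tensor3 \<beta>"
  shows "tensor2_lift \<beta> (tensor2 x y) = \<beta> x y"
proof -
  have "\<beta> x y \<in> range (coset tensor3_null)"
    using assms by (simp add: bilinear_to_tensor3_def tensor3_space_def)
  thus ?thesis
    by (simp add: tensor2_def tensor2_lift_coset[OF assms] coset_coset_rep[OF subspace_tensor3_null])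
qed

lemma tensor2_lift_add:
  assumes "bilinear_to_tensor3 \<beta>" "X \<in> tensor2_space" "Y \<in> tensor2_space"
  shows "tensor2_lift \<beta> (coset_add X Y) = coset_add (tensor2_lift \<beta> X) (tensor2_lift \<beta> Y)"
proof -
  interpret F: Vector_Spaces.linear free_scale free_scale "free_ext (\<lambda>(x, y). coset_rep (\<beta> x y))"
    by (rule linear_free_ext)
  show ?thesis using assms(2,3)
    by (auto simp: tensor2_space_def coset_add_coset[OF subspace_tensor2_null]
        coset_add_coset[OF subspace_tensor3_null] tensor2_lift_coset[OF assms(1)] F.add)
qed

lemma tensor2_lift_scale:
  assumes "bilinear_to_tensor3 \<beta>" "X \<in> tensor2_space"
  shows "tensor2_lift \<beta> (coset_scale tensor2_null k X) = coset_scale tensor3_null k (tensor2_lift \<beta> X)"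
proof -
  interpret F: Vector_Spaces.linear free_scale free_scale "free_ext (\<lambda>(x, y). coset_rep (\<beta> x y))"
    by (rule linear_free_ext)
  show ?thesis using assms(2)
    by (auto simp: tensor2_space_def coset_scale_coset[OF subspace_tensor2_null]
        coset_scale_coset[OF subspace_tensor3_null] tensor2_lift_coset[OF assms(1)] F.scale)
qed

lemma tensor3_add_scale:
  "tensor3 (x + x') y z = coset_add (tensor3 x y z) (tensor3 x' y z)"
  "tensor3 x (y + y') z = coset_add (tensor3 x y z) (tensor3 x y' z)"
  "tensor3 x y (z + z') = coset_add (tensor3 x y z) (tensor3 x y z')"
  "tensor3 (scale k x) y z = coset_scale tensor3_null k (tensor3 x y z)"
  "tensor3 x (scale k y) z = coset_scale tensor3_null k (tensor3 x y z)"
  "tensor3 x y (scale k z) = coset_scale tensor3_null k (tensor3 x y z)"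
  unfolding tensor3_def coset_add_coset[OF subspace_tensor3_null]
    coset_scale_coset[OF subspace_tensor3_null] coset_eq_iff[OF subspace_tensor3_null]
    diff_diff_add[symmetric]
  unfolding tensor3_null_def
  by - (rule free.span_base, simp only: Un_iff mem_Collect_eq, metis)+

lemma bilinear_tensor3:
  "bilinear_to_tensor3 (\<lambda>x y. tensor3 x y z)" "bilinear_to_tensor3 (\<lambda>x y. tensor3 z x y)"
  unfolding bilinear_to_tensor3_def tensor3_add_scale by (auto simp: tensor3_space_def tensor3_def)

lemma tensor_right_tensor2 [simp]: "tensor_right (tensor2 x y) z = tensor3 x y z"
  by (simp add: tensor_right_def tensor2_lift_tensor2 bilinear_tensor3)

lemma tensor_left_tensor2 [simp]: "tensor_left z (tensor2 x y) = tensor3 z x y"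
  by (simp add: tensor_left_def tensor2_lift_tensor2 bilinear_tensor3)

lemma tensor2_lift_cong_ops:
  assumes "bilinear_to_tensor3 \<beta>" "X \<in> tensor2_space"
  shows "\<lbrakk>bilinear_to_tensor3 \<beta>'; bilinear_to_tensor3 \<beta>''; \<And>x y. \<beta> x y = coset_add (\<beta>' x y) (\<beta>'' x y)\<rbrakk>
    \<Longrightarrow> tensor2_lift \<beta> X = coset_add (tensor2_lift \<beta>' X) (tensor2_lift \<beta>'' X)"
    and "\<lbrakk>bilinear_to_tensor3 \<beta>'; \<And>x y. \<beta> x y = coset_scale tensor3_null k (\<beta>' x y)\<rbrakk>
    \<Longrightarrow> tensor2_lift \<beta> X = coset_scale tensor3_null k (tensor2_lift \<beta>' X)"
proof -
  note N3 = subspace_tensor3_null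
  have r: "coset tensor3_null (coset_rep (\<gamma> x y)) = \<gamma> x y" if "bilinear_to_tensor3 \<gamma>" for \<gamma> x y
    by (rule coset_coset_rep[OF N3])
       (use that in \<open>simp add: bilinear_to_tensor3_def tensor3_space_def\<close>)
  obtain u where X: "X = coset tensor2_null u" using assms(2) by (auto simp: tensor2_space_def)
  let ?g = "\<lambda>\<gamma> (x, y). coset_rep (\<gamma> x y)"
  { assume b: "bilinear_to_tensor3 \<beta>'" "bilinear_to_tensor3 \<beta>''"
      and eq: "\<And>x y. \<beta> x y = coset_add (\<beta>' x y) (\<beta>'' x y)"
    have "coset_rep (\<beta> x y) - (coset_rep (\<beta>' x y) + coset_rep (\<beta>'' x y)) \<in> tensor3_null" for x y
      using eq[of x y] r[OF assms(1), of x y] r[OF b(1), of x y] r[OF b(2), of x y]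
        coset_add_coset[OF N3] coset_eq_iff[OF N3] by metis
    hence "(\<Sum>i\<in>Poly_Mapping.keys u. free_scale (Poly_Mapping.lookup u i)
        (?g \<beta> i - (?g \<beta>' i + ?g \<beta>'' i))) \<in> tensor3_null"
      by (intro free.subspace_sum[OF N3] free.subspace_scale[OF N3]) (auto split: prod.split)
    hence "free_ext (?g \<beta>) u - (free_ext (?g \<beta>') u + free_ext (?g \<beta>'') u) \<in> tensor3_null"
      by (simp add: free_ext_def free.scale_right_diff_distrib free.scale_right_distrib
          sum_subtractf sum.distrib)
    thus "tensor2_lift \<beta> X = coset_add (tensor2_lift \<beta>' X) (tensor2_lift \<beta>'' X)"
      by (simp add: X tensor2_lift_coset assms(1) b coset_add_coset[OF N3] coset_eq_iff[OF N3]) }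
  { assume b: "bilinear_to_tensor3 \<beta>'"
      and eq: "\<And>x y. \<beta> x y = coset_scale tensor3_null k (\<beta>' x y)"
    have "coset_rep (\<beta> x y) - free_scale k (coset_rep (\<beta>' x y)) \<in> tensor3_null" for x y
      using eq[of x y] r[OF assms(1), of x y] r[OF b, of x y]
        coset_scale_coset[OF N3] coset_eq_iff[OF N3] by metis
    hence "(\<Sum>i\<in>Poly_Mapping.keys u. free_scale (Poly_Mapping.lookup u i)
        (?g \<beta> i - free_scale k (?g \<beta>' i))) \<in> tensor3_null"
      by (intro free.subspace_sum[OF N3] free.subspace_scale[OF N3]) (auto split: prod.split)
    hence "free_ext (?g \<beta>) u - free_scale k (free_ext (?g \<beta>') u) \<in> tensor3_null"
      by (simp add: free_ext_def free.scale_right_diff_distrib free.scale_sum_right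
          sum_subtractf mult.commute)
    thus "tensor2_lift \<beta> X = coset_scale tensor3_null k (tensor2_lift \<beta>' X)"
      by (simp add: X tensor2_lift_coset assms(1) b coset_scale_coset[OF N3] coset_eq_iff[OF N3]) }
qed

lemma tensor2_lift_space: "tensor2_lift \<beta> X \<in> tensor3_space"
  by (simp add: tensor2_lift_def tensor3_space_def)

lemma bilinear_tensor_right:
  assumes f: "linear_to_tensor2 f"
  shows "bilinear_to_tensor3 (\<lambda>x y. tensor_right (f x) y)"
proof -
  have "f x \<in> tensor2_space" for x using f by (simp add: linear_to_tensor2_def)
  note this [simp] and * = bilinear_tensor3(1) tensor2_lift_cong_ops[OF bilinear_tensor3(1)]
  show ?thesis
    unfolding bilinear_to_tensor3_def tensor_right_def
  proof (intro conjI allI)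
    fix x x' y y' k
    show "tensor2_lift (\<lambda>a b. tensor3 a b (y + y')) (f x) =
        coset_add (tensor2_lift (\<lambda>a b. tensor3 a b y) (f x)) (tensor2_lift (\<lambda>a b. tensor3 a b y') (f x))"
      by (rule *) (simp_all add: bilinear_tensor3 tensor3_add_scale)
    show "tensor2_lift (\<lambda>a b. tensor3 a b (scale k y)) (f x) =
        coset_scale tensor3_null k (tensor2_lift (\<lambda>a b. tensor3 a b y) (f x))"
      by (rule *) (simp_all add: bilinear_tensor3 tensor3_add_scale)
  qed (use f in \<open>simp_all add: linear_to_tensor2_def tensor2_lift_space tensor2_lift_add
        tensor2_lift_scale bilinear_tensor3\<close>)
qed

lemma bilinear_tensor_left:
  assumes f: "linear_to_tensor2 f"
  shows "bilinear_to_tensor3 (\<lambda>x y. tensor_left x (f y))"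
proof -
  have "f x \<in> tensor2_space" for x using f by (simp add: linear_to_tensor2_def)
  note this [simp] and * = bilinear_tensor3(2) tensor2_lift_cong_ops[OF bilinear_tensor3(2)]
  show ?thesis
    unfolding bilinear_to_tensor3_def tensor_left_def
  proof (intro conjI allI)
    fix x x' y y' k
    show "tensor2_lift (tensor3 (x + x')) (f y) =
        coset_add (tensor2_lift (tensor3 x) (f y)) (tensor2_lift (tensor3 x') (f y))"
      by (rule *) (simp_all add: bilinear_tensor3 tensor3_add_scale)
    show "tensor2_lift (tensor3 (scale k x)) (f y) =
        coset_scale tensor3_null k (tensor2_lift (tensor3 x) (f y))"
      by (rule *) (simp_all add: bilinear_tensor3 tensor3_add_scale)
  qed (use f in \<open>simp_all add: linear_to_tensor2_def tensor2_lift_space tensor2_lift_add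
        tensor2_lift_scale bilinear_tensor3\<close>)
qed

lemma map_tensor_id_tensor2:
  "linear_to_tensor2 f \<Longrightarrow> map_tensor_id f (tensor2 x y) = tensor_right (f x) y"
  by (simp add: map_tensor_id_def tensor2_lift_tensor2 bilinear_tensor_right)

lemma id_tensor_map_tensor2:
  "linear_to_tensor2 f \<Longrightarrow> id_tensor_map f (tensor2 x y) = tensor_left x (f y)"
  by (simp add: id_tensor_map_def tensor2_lift_tensor2 bilinear_tensor_left)

end


section \<open>Coalgebras without counit\<close>

locale coalgebra = vector_space scale
  for scale :: "'k::field \<Rightarrow> 'c::ab_group_add \<Rightarrow> 'c" +
  fixes \<delta> :: "'c \<Rightarrow> ('c \<times> 'c \<Rightarrow>\<^sub>0 'k) set"
  assumes linear_comult: "linear_to_tensor2 \<delta>"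
    and coassoc: "map_tensor_id \<delta> (\<delta> c) = id_tensor_map \<delta> (\<delta> c)"
begin

definition subcoalgebra :: "'c set \<Rightarrow> bool" where
  "subcoalgebra D \<longleftrightarrow> subspace D \<and> \<delta> ` D \<subseteq> tensor2_sub D"

definition is_subcoalgebra_generated_by :: "'c set \<Rightarrow> 'c \<Rightarrow> bool" where
  "is_subcoalgebra_generated_by D c \<longleftrightarrow>
     subcoalgebra D \<and> c \<in> D \<and> (\<forall>E. subcoalgebra E \<and> c \<in> E \<longrightarrow> D \<subseteq> E)"

end

end

theory Submission
  imports Defs
begin

text \<open>Coassociativity turns contraction of one factor of \<open>\<delta> x\<close> with linear functionals into two
  commuting actions on \<open>C\<close>. For \<open>\<delta> x = \<Sum>\<^sub>i a\<^sub>i \<otimes> b\<^sub>i\<close> they are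
  \<open>act_left f x = \<Sum>\<^sub>i f a\<^sub>i b\<^sub>i\<close> and \<open>act_right f x = \<Sum>\<^sub>i f b\<^sub>i a\<^sub>i\<close>. A subspace is a subcoalgebra
  iff it is stable under all these operators (\<open>subcoalgebra_iff_act\<close>). This rests on
  \<open>(D \<otimes> C) \<inter> (C \<otimes> D) = D \<otimes> D\<close>, in the form that a tensor lies in \<open>D \<otimes> D\<close> as soon as all its
  contractions lie in \<open>D\<close> (\<open>mem_tensor2_sub_if_contractions\<close>).

  The subcoalgebra generated by \<open>c\<close> is therefore the smallest stable subspace containing \<open>c\<close>.
  Contracting two of the three factors of the iterated comultiplication in its two forms shows
  that a product of two left operators is again a left operator, that the same is true on the
  right, and that left and right operators commute. Hence the smallest stable subspace is spanned
  by \<open>c\<close> and all \<open>act_left f c\<close>, \<open>act_right g c\<close> and \<open>act_left f (act_right g c)\<close>, the first three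
  kinds being needed because without a counit the identity need not be among the operators. As
  \<open>\<delta> x\<close> is a finite sum of elementary tensors, \<open>act_left f x\<close> and \<open>act_right f x\<close> stay in
  finite-dimensional spaces depending only on \<open>x\<close>, and so the span is finite dimensional.\<close>

section \<open>Evaluating multilinear maps on tensors\<close>

context vector_space
begin

definition free_eval :: "('i \<Rightarrow> 'b) \<Rightarrow> ('i \<Rightarrow>\<^sub>0 'a) \<Rightarrow> 'b" where
  "free_eval g u = (\<Sum>i\<in>Poly_Mapping.keys u. scale (Poly_Mapping.lookup u i) (g i))"

lemma free_eval_superset:
  assumes "finite S" "Poly_Mapping.keys u \<subseteq> S"
  shows "free_eval g u = (\<Sum>i\<in>S. scale (Poly_Mapping.lookup u i) (g i))"
  unfolding free_eval_def using assms
  by (intro sum.mono_neutral_left) (auto simp: in_keys_iff)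

lemma linear_free_eval:
  fixes g :: "'i \<Rightarrow> 'b"
  shows "Vector_Spaces.linear free_scale scale (free_eval g)"
proof unfold_locales
  fix u v :: "'i \<Rightarrow>\<^sub>0 'a" and k :: 'a
  let ?S = "Poly_Mapping.keys u \<union> Poly_Mapping.keys v"
  show "free_eval g (u + v) = free_eval g u + free_eval g v"
    using keys_add[of u v]
    by (simp add: free_eval_superset[of ?S] lookup_add scale_left_distrib sum.distrib)
  have "Poly_Mapping.keys (free_scale k u) \<subseteq> Poly_Mapping.keys u"
    by (auto simp: in_keys_iff)
  thus "free_eval g (free_scale k u) = scale k (free_eval g u)"
    by (simp add: free_eval_superset[of "Poly_Mapping.keys u"] scale_sum_right)
qed

lemma free_eval_add: "free_eval g (u + v) = free_eval g u + free_eval g v"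
  and free_eval_scale: "free_eval g (free_scale k u) = scale k (free_eval g u)"
  using linear_free_eval[of g] by (simp_all add: Vector_Spaces.linear_iff)

lemma free_eval_diff: "free_eval g (u - v) = free_eval g u - free_eval g v"
  using free_eval_add[of g "u - v" v] by simp

lemma free_eval_zero: "free_eval g 0 = 0"
  by (simp add: free_eval_def)

lemma free_eval_sum: "free_eval g (sum u I) = (\<Sum>i\<in>I. free_eval g (u i))"
  by (induction I rule: infinite_finite_induct) (simp_all add: free_eval_add free_eval_zero)

lemma free_eval_gen [simp]: "free_eval g (free_gen i) = g i"
  by (simp add: free_eval_def free_gen_def)

lemma free_eval_free_ext: "free_eval g (free_ext h u) = free_eval (\<lambda>i. free_eval g (h i)) u"
  by (simp add: free_ext_def free_eval_sum free_eval_scale free_eval_def[of "\<lambda>i. free_eval g (h i)"])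

lemma linear_apply_free_eval:
  assumes "Vector_Spaces.linear scale s f"
  shows "f (free_eval g u) = (\<Sum>i\<in>Poly_Mapping.keys u. s (Poly_Mapping.lookup u i) (f (g i)))"
proof -
  interpret Vector_Spaces.linear scale s f by fact
  show ?thesis by (simp add: free_eval_def sum scale)
qed

lemma free_eval_tensor2_null:
  assumes B: "\<And>y. Vector_Spaces.linear scale scale (\<lambda>x. B (x, y))"
    "\<And>x. Vector_Spaces.linear scale scale (\<lambda>y. B (x, y))"
    and u: "u \<in> tensor2_null"
  shows "free_eval B u = 0"
proof -
  have "tensor2_null \<subseteq> {u. free_eval B u = 0}"
    unfolding tensor2_null_def
    by (rule free.span_minimal)
       (use B in \<open>auto simp: Vector_Spaces.linear_iff free.subspace_def
          free_eval_zero free_eval_diff free_eval_add free_eval_scale\<close>)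
  with u show ?thesis by blast
qed

lemma free_eval_tensor3_null:
  assumes T: "\<And>y z. Vector_Spaces.linear scale scale (\<lambda>x. T (x, y, z))"
    "\<And>x z. Vector_Spaces.linear scale scale (\<lambda>y. T (x, y, z))"
    "\<And>x y. Vector_Spaces.linear scale scale (\<lambda>z. T (x, y, z))"
    and u: "u \<in> tensor3_null"
  shows "free_eval T u = 0"
proof -
  have "tensor3_null \<subseteq> {u. free_eval T u = 0}"
    unfolding tensor3_null_def
    by (rule free.span_minimal)
       (use T in \<open>auto simp: Vector_Spaces.linear_iff free.subspace_def
          free_eval_zero free_eval_diff free_eval_add free_eval_scale\<close>)
  with u show ?thesis by blast
qed

text \<open>A map that kills the relations may be evaluated on any representative of a coset, in
  particular on the one picked by \<open>coset_rep\<close>.\<close>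

lemma free_eval_coset_rep:
  assumes N: "free.subspace N" and null: "\<And>n. n \<in> N \<Longrightarrow> free_eval g n = 0"
  shows "free_eval g (coset_rep (coset N u)) = free_eval g u"
proof -
  have "coset N (coset_rep (coset N u)) = coset N u"
    by (rule coset_coset_rep[OF N]) simp
  hence "coset_rep (coset N u) - u \<in> N" by (simp add: coset_eq_iff[OF N])
  from null[OF this] show ?thesis by (simp add: free_eval_diff)
qed

lemma free_eval_tensor2_lift:
  assumes "\<And>y z. Vector_Spaces.linear scale scale (\<lambda>x. T (x, y, z))"
    "\<And>x z. Vector_Spaces.linear scale scale (\<lambda>y. T (x, y, z))"
    "\<And>x y. Vector_Spaces.linear scale scale (\<lambda>z. T (x, y, z))"
  shows "free_eval T (coset_rep (tensor2_lift \<beta> X))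
    = free_eval (\<lambda>(x, y). free_eval T (coset_rep (\<beta> x y))) (coset_rep X)"
  unfolding tensor2_lift_eq
  by (subst free_eval_coset_rep[OF subspace_tensor3_null])
     (auto simp: free_eval_free_ext case_prod_unfold intro!: free_eval_tensor3_null[of T] assms)

lemma free_eval_tensor_right:
  assumes "\<And>y z. Vector_Spaces.linear scale scale (\<lambda>x. T (x, y, z))"
    "\<And>x z. Vector_Spaces.linear scale scale (\<lambda>y. T (x, y, z))"
    "\<And>x y. Vector_Spaces.linear scale scale (\<lambda>z. T (x, y, z))"
  shows "free_eval T (coset_rep (tensor_right X z))
    = free_eval (\<lambda>(x, y). T (x, y, z)) (coset_rep X)"
  unfolding tensor_right_def free_eval_tensor2_lift[OF assms] tensor3_def
  by (subst free_eval_coset_rep[OF subspace_tensor3_null])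
     (auto intro!: free_eval_tensor3_null[of T] assms)

lemma free_eval_tensor_left:
  assumes "\<And>y z. Vector_Spaces.linear scale scale (\<lambda>x. T (x, y, z))"
    "\<And>x z. Vector_Spaces.linear scale scale (\<lambda>y. T (x, y, z))"
    "\<And>x y. Vector_Spaces.linear scale scale (\<lambda>z. T (x, y, z))"
  shows "free_eval T (coset_rep (tensor_left z X))
    = free_eval (\<lambda>(x, y). T (z, x, y)) (coset_rep X)"
  unfolding tensor_left_def free_eval_tensor2_lift[OF assms] tensor3_def
  by (subst free_eval_coset_rep[OF subspace_tensor3_null])
     (auto intro!: free_eval_tensor3_null[of T] assms)


section \<open>Contracting a tensor with a functional\<close>

abbreviation functional :: "('b \<Rightarrow> 'a) \<Rightarrow> bool" where
  "functional \<equiv> Vector_Spaces.linear scale (*)"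

lemma functional_iff:
  "functional f \<longleftrightarrow> (\<forall>x y. f (x + y) = f x + f y) \<and> (\<forall>k x. f (scale k x) = k * f x)"
proof -
  have "vector_space ((*) :: 'a \<Rightarrow> 'a \<Rightarrow> 'a)" by unfold_locales (simp_all add: algebra_simps)
  thus ?thesis by (simp add: Vector_Spaces.linear_iff vector_space_axioms)
qed

lemma endomorphism_iff:
  "Vector_Spaces.linear scale scale h
    \<longleftrightarrow> (\<forall>x y. h (x + y) = h x + h y) \<and> (\<forall>k x. h (scale k x) = scale k (h x))"
  by (simp add: Vector_Spaces.linear_iff vector_space_axioms)

definition contract_left :: "('b \<Rightarrow> 'a) \<Rightarrow> ('b \<times> 'b \<Rightarrow>\<^sub>0 'a) set \<Rightarrow> 'b" where
  "contract_left f X = free_eval (\<lambda>(x, y). scale (f x) y) (coset_rep X)"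

definition contract_right :: "('b \<Rightarrow> 'a) \<Rightarrow> ('b \<times> 'b \<Rightarrow>\<^sub>0 'a) set \<Rightarrow> 'b" where
  "contract_right f X = free_eval (\<lambda>(x, y). scale (f y) x) (coset_rep X)"

lemma contract_left_coset:
  assumes "functional f"
  shows "contract_left f (coset tensor2_null u) = free_eval (\<lambda>(x, y). scale (f x) y) u"
  unfolding contract_left_def using assms
  by (intro free_eval_coset_rep[OF subspace_tensor2_null]
        free_eval_tensor2_null[of "\<lambda>(x, y). scale (f x) y"])
     (auto simp: endomorphism_iff functional_iff algebra_simps)

lemma contract_right_coset:
  assumes "functional f"
  shows "contract_right f (coset tensor2_null u) = free_eval (\<lambda>(x, y). scale (f y) x) u"
  unfolding contract_right_def using assms
  by (intro free_eval_coset_rep[OF subspace_tensor2_null]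
        free_eval_tensor2_null[of "\<lambda>(x, y). scale (f y) x"])
     (auto simp: endomorphism_iff functional_iff algebra_simps)

lemma contract_in_subspace:
  assumes D: "subspace D" and X: "X \<in> tensor2_sub D" and f: "functional f"
  shows "contract_left f X \<in> D" "contract_right f X \<in> D"
proof -
  obtain u where u: "X = coset tensor2_null u" "Poly_Mapping.keys u \<subseteq> D \<times> D"
    using X by (auto simp: tensor2_sub_def)
  show "contract_left f X \<in> D" "contract_right f X \<in> D"
    unfolding u(1) contract_left_coset[OF f] contract_right_coset[OF f] free_eval_def
    using u(2) by (auto intro!: subspace_sum[OF D] subspace_scale[OF D])
qed

text \<open>The bilinear relations expand one factor at a time: first \<open>x\<close> against a fixed element of \<open>B\<close>,
  and then \<open>y\<close>, whose expansion consists of terms of the kind just treated.\<close>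

lemma free_gen_in_span_basis:
  assumes "x \<in> span B" "y \<in> span B"
  shows "free_gen (x, y) \<in> free.span (tensor2_null \<union> free_gen ` (B \<times> B))"
proof -
  let ?S = "free.span (tensor2_null \<union> free_gen ` (B \<times> B))"
  note N = subspace_tensor2_null
  have null: "n \<in> ?S" if "n \<in> tensor2_null" for n
    by (intro free.span_base) (use that in auto)
  have close: "v \<in> ?S" if "v - w \<in> tensor2_null" "w \<in> ?S" for v w
    using free.span_add[OF null[OF that(1)] that(2)] by simp
  have add1: "free_gen (x + x', y) - (free_gen (x, y) + free_gen (x', y)) \<in> tensor2_null" for x x' y
    unfolding tensor2_null_def diff_diff_eq[symmetric] by (rule free.span_base) blast
  have add2: "free_gen (x, y + y') - (free_gen (x, y) + free_gen (x, y')) \<in> tensor2_null" for x y y'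
    unfolding tensor2_null_def diff_diff_eq[symmetric] by (rule free.span_base) blast
  have scale1: "free_gen (scale k x, y) - free_scale k (free_gen (x, y)) \<in> tensor2_null" for k x y
    unfolding tensor2_null_def by (rule free.span_base) blast
  have scale2: "free_gen (x, scale k y) - free_scale k (free_gen (x, y)) \<in> tensor2_null" for k x y
    unfolding tensor2_null_def by (rule free.span_base) blast
  have zero1: "free_gen (0, y) \<in> ?S" for y
    using close[OF scale1[of 0 0 y]] by (simp add: free.span_zero)
  have zero2: "free_gen (x, 0) \<in> ?S" for x
    using close[OF scale2[of x 0 0]] by (simp add: free.span_zero)
  have step: "free_gen (x, b) \<in> ?S" if "b \<in> B" for b
    using assms(1)
  proof (induction rule: span_induct_alt)
    case base
    show ?case by (rule zero1)
  next
    case (step k a z)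
    have "free_gen (a, b) \<in> ?S" using step(1) that by (intro free.span_base) auto
    hence "free_gen (scale k a, b) \<in> ?S" by (intro close[OF scale1] free.span_scale)
    thus ?case by (intro close[OF add1] free.span_add step)
  qed
  show ?thesis using assms(2)
  proof (induction rule: span_induct_alt)
    case base
    show ?case by (rule zero2)
  next
    case (step k a z)
    have "free_gen (x, scale k a) \<in> ?S"
      by (intro close[OF scale2] free.span_scale \<open>\<And>b. b \<in> B \<Longrightarrow> free_gen (x, b) \<in> ?S\<close> step)
    thus ?case by (intro close[OF add2] free.span_add step)
  qed
qed

lemma free_eq_sum_gen:
  "u = (\<Sum>i\<in>Poly_Mapping.keys u. free_scale (Poly_Mapping.lookup u i) (free_gen i))"
proof (rule poly_mapping_eqI)
  fix j
  show "Poly_Mapping.lookup u j = Poly_Mapping.lookup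
      (\<Sum>i\<in>Poly_Mapping.keys u. free_scale (Poly_Mapping.lookup u i) (free_gen i)) j"
    by (simp add: lookup_sum free_gen_def lookup_single when_def in_keys_iff
        if_distrib[of "\<lambda>t. _ * t"] sum.delta cong: if_cong)
qed

text \<open>Over a basis \<open>B\<close> of \<open>V\<close>, tensors can be written with matrix coefficients indexed by
  \<open>B \<times> B\<close>.\<close>

lemma tensor2_basis_representative:
  assumes "span B = UNIV"
  obtains w where "coset tensor2_null u = coset tensor2_null w" "Poly_Mapping.keys w \<subseteq> B \<times> B"
proof -
  have "(\<Sum>i\<in>Poly_Mapping.keys u. free_scale (Poly_Mapping.lookup u i) (free_gen i))
      \<in> free.span (tensor2_null \<union> free_gen ` (B \<times> B))"
    by (intro free.span_sum free.span_scale)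
       (use free_gen_in_span_basis[of _ B] assms in \<open>auto simp: image_iff\<close>)
  then obtain n w where nw: "u = n + w" "n \<in> tensor2_null" "w \<in> free.span (free_gen ` (B \<times> B))"
    unfolding free_eq_sum_gen[symmetric] free.span_Un free.span_eq_iff[THEN iffD2, OF subspace_tensor2_null]
    by blast
  have "free.span (free_gen ` (B \<times> B)) \<subseteq> {w :: 'b \<times> 'b \<Rightarrow>\<^sub>0 'a. Poly_Mapping.keys w \<subseteq> B \<times> B}"
  proof (rule free.span_minimal)
    show "free.subspace {w :: 'b \<times> 'b \<Rightarrow>\<^sub>0 'a. Poly_Mapping.keys w \<subseteq> B \<times> B}"
    proof (rule free.subspaceI)
      fix v w :: "'b \<times> 'b \<Rightarrow>\<^sub>0 'a"
      assume "v \<in> {w. Poly_Mapping.keys w \<subseteq> B \<times> B}" "w \<in> {w. Poly_Mapping.keys w \<subseteq> B \<times> B}"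
      thus "v + w \<in> {w. Poly_Mapping.keys w \<subseteq> B \<times> B}" using keys_add[of v w] by blast
    next
      fix k and w :: "'b \<times> 'b \<Rightarrow>\<^sub>0 'a"
      assume "w \<in> {w. Poly_Mapping.keys w \<subseteq> B \<times> B}"
      moreover have "Poly_Mapping.keys (free_scale k w) \<subseteq> Poly_Mapping.keys w"
        by (auto simp: in_keys_iff)
      ultimately show "free_scale k w \<in> {w. Poly_Mapping.keys w \<subseteq> B \<times> B}" by blast
    qed simp
  qed (auto simp: free_gen_def)
  with nw show ?thesis
    by (intro that[of w]) (auto simp: coset_eq_iff[OF subspace_tensor2_null])
qed

text \<open>Take a basis of \<open>D\<close>, extended to a basis of \<open>V\<close>. Contracting \<open>X\<close> with dual basis functionals
  reads off the rows and columns of its coefficient matrix; since they represent vectors of \<open>D\<close>,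
  only coefficients at pairs of basis vectors of \<open>D\<close> can be nonzero.\<close>

lemma mem_tensor2_sub_if_contractions:
  assumes D: "subspace D" and X: "X \<in> tensor2_space"
    and l: "\<And>f. functional f \<Longrightarrow> contract_left f X \<in> D"
    and r: "\<And>f. functional f \<Longrightarrow> contract_right f X \<in> D"
  shows "X \<in> tensor2_sub D"
proof -
  obtain A where A: "A \<subseteq> D" "independent A" "D \<subseteq> span A"
    by (rule maximal_independent_subset[of D])
  obtain B where B: "A \<subseteq> B" "independent B" "UNIV \<subseteq> span B"
    by (rule maximal_independent_subset_extend[OF subset_UNIV A(2)])
  obtain u where u: "X = coset tensor2_null u" using X unfolding tensor2_space_def ..
  obtain w where w: "X = coset tensor2_null w" "Poly_Mapping.keys w \<subseteq> B \<times> B"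
  proof (rule tensor2_basis_representative)
    show "span B = UNIV" using B(3) by blast
  qed (simp add: u)
  define coord where "coord b v = representation B v b" for b v
  have span: "v \<in> span B" for v using B(3) by blast
  have coord: "functional (coord b)" for b
    by (simp add: functional_iff coord_def representation_add representation_scale B span)
  have coord_basis: "coord b v = (if v = b then 1 else 0)" if "v \<in> B" for b v
    using that by (auto simp: coord_def representation_basis[OF B(2)])
  have coord_D: "coord b v = 0" if "v \<in> D" "b \<notin> A" for b v
  proof -
    have "representation B v = representation A v"
      using A(3) that(1) by (intro representation_extend[OF B(2) _ B(1)]) auto
    thus ?thesis using that(2) representation_ne_zero[of A v b] by (auto simp: coord_def)
  qed
  have "Poly_Mapping.keys w \<subseteq> A \<times> A"
  proof clarify
    fix a b assume ab: "(a, b) \<in> Poly_Mapping.keys w"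
    have "Poly_Mapping.lookup w i * coord b (case i of (x, y) \<Rightarrow> scale (coord a x) y)
        = (if i = (a, b) then Poly_Mapping.lookup w i else 0)" if "i \<in> Poly_Mapping.keys w" for i
      using that w(2) coord[of b] by (cases i) (auto simp: functional_iff coord_basis)
    hence "coord b (contract_left (coord a) X) = Poly_Mapping.lookup w (a, b)"
      unfolding w(1) contract_left_coset[OF coord] linear_apply_free_eval[OF coord]
      using ab by (simp add: sum.delta)
    hence "b \<in> A" using coord_D[OF l[OF coord]] ab by (metis in_keys_iff)
    have "Poly_Mapping.lookup w i * coord a (case i of (x, y) \<Rightarrow> scale (coord b y) x)
        = (if i = (a, b) then Poly_Mapping.lookup w i else 0)" if "i \<in> Poly_Mapping.keys w" for i
      using that w(2) coord[of a] by (cases i) (auto simp: functional_iff coord_basis)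
    hence "coord a (contract_right (coord b) X) = Poly_Mapping.lookup w (a, b)"
      unfolding w(1) contract_right_coset[OF coord] linear_apply_free_eval[OF coord]
      using ab by (simp add: sum.delta)
    hence "a \<in> A" using coord_D[OF r[OF coord]] ab by (metis in_keys_iff)
    with \<open>b \<in> A\<close> show "a \<in> A \<and> b \<in> A" by blast
  qed
  with A(1) w(1) show ?thesis unfolding tensor2_sub_def by blast
qed

lemma finite_dimensional_subspace_of_finite_span:
  assumes D: "subspace D" and S: "finite S" "D \<subseteq> span S"
  shows "finite_dimensional D"
proof -
  obtain B where B: "B \<subseteq> D" "independent B" "D \<subseteq> span B"
    by (rule maximal_independent_subset[of D])
  have "finite B" using independent_span_bound[OF S(1) B(2)] B(1) S(2) by blast
  moreover have "span B = D" using B span_minimal[OF B(1) D] by blast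
  ultimately show ?thesis unfolding finite_dimensional_def by blast
qed

end


section \<open>The two actions of functionals on a coalgebra\<close>

context coalgebra
begin

definition act_left :: "('c \<Rightarrow> 'k) \<Rightarrow> 'c \<Rightarrow> 'c" where
  "act_left f x = contract_left f (\<delta> x)"

definition act_right :: "('c \<Rightarrow> 'k) \<Rightarrow> 'c \<Rightarrow> 'c" where
  "act_right f x = contract_right f (\<delta> x)"

lemma comult_coset: "\<exists>u. \<delta> x = coset tensor2_null u"
proof -
  have "\<delta> x \<in> tensor2_space" using linear_comult by (simp add: linear_to_tensor2_def)
  thus ?thesis by (simp add: tensor2_space_def image_iff)
qed

lemma comult_add: "\<delta> (x + y) = coset_add (\<delta> x) (\<delta> y)"
  and comult_scale: "\<delta> (scale k x) = coset_scale tensor2_null k (\<delta> x)"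
  using linear_comult by (simp_all add: linear_to_tensor2_def)

lemma linear_act:
  assumes f: "functional f"
  shows "Vector_Spaces.linear scale scale (act_left f)"
    and "Vector_Spaces.linear scale scale (act_right f)"
proof -
  { fix x y k
    obtain u where u: "\<delta> x = coset tensor2_null u" using comult_coset ..
    obtain v where v: "\<delta> y = coset tensor2_null v" using comult_coset ..
    have "act_left f (x + y) = act_left f x + act_left f y"
      "act_left f (scale k x) = scale k (act_left f x)"
      "act_right f (x + y) = act_right f x + act_right f y"
      "act_right f (scale k x) = scale k (act_right f x)"
      by (simp_all add: act_left_def act_right_def comult_add comult_scale u v
          coset_add_coset coset_scale_coset subspace_tensor2_null
          contract_left_coset[OF f] contract_right_coset[OF f] free_eval_add free_eval_scale) }
  thus "Vector_Spaces.linear scale scale (act_left f)"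
    "Vector_Spaces.linear scale scale (act_right f)"
    by (simp_all add: endomorphism_iff)
qed

text \<open>Stability under a family of linear operators is preserved by arbitrary intersections, and the
  smallest stable subspace containing \<open>c\<close> is spanned by the images of \<open>c\<close> under products of these
  operators.\<close>

lemma subcoalgebra_iff_act:
  "subcoalgebra D \<longleftrightarrow> subspace D \<and>
    (\<forall>f x. functional f \<longrightarrow> x \<in> D \<longrightarrow> act_left f x \<in> D \<and> act_right f x \<in> D)"
proof (cases "subspace D")
  case True
  have "\<delta> x \<in> tensor2_sub D \<longleftrightarrow> (\<forall>f. functional f \<longrightarrow> act_left f x \<in> D \<and> act_right f x \<in> D)" for x
  proof
    assume "\<delta> x \<in> tensor2_sub D"
    with True show "\<forall>f. functional f \<longrightarrow> act_left f x \<in> D \<and> act_right f x \<in> D"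
      unfolding act_left_def act_right_def by (blast intro: contract_in_subspace)
  next
    assume act: "\<forall>f. functional f \<longrightarrow> act_left f x \<in> D \<and> act_right f x \<in> D"
    have "\<delta> x \<in> tensor2_space"
      using linear_comult by (simp add: linear_to_tensor2_def)
    with True show "\<delta> x \<in> tensor2_sub D"
      by (rule mem_tensor2_sub_if_contractions)
         (use act in \<open>simp_all add: act_left_def act_right_def\<close>)
  qed
  with True show ?thesis unfolding subcoalgebra_def by blast
qed (simp add: subcoalgebra_def)

text \<open>The common source of the composition laws of the two actions: evaluate a trilinear map on
  both sides of the coassociativity identity.\<close>

lemma coassoc_eval:
  assumes T: "\<And>y z. Vector_Spaces.linear scale scale (\<lambda>x. T (x, y, z))"
    "\<And>x z. Vector_Spaces.linear scale scale (\<lambda>y. T (x, y, z))"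
    "\<And>x y. Vector_Spaces.linear scale scale (\<lambda>z. T (x, y, z))"
  shows "free_eval (\<lambda>(x, z). free_eval (\<lambda>(a, b). T (a, b, z)) (coset_rep (\<delta> x))) (coset_rep (\<delta> c))
    = free_eval (\<lambda>(x, z). free_eval (\<lambda>(a, b). T (x, a, b)) (coset_rep (\<delta> z))) (coset_rep (\<delta> c))"
  using arg_cong[OF coassoc[of c], of "\<lambda>X. free_eval T (coset_rep X)"]
  by (simp add: map_tensor_id_def id_tensor_map_def free_eval_tensor2_lift[OF T]
      free_eval_tensor_right[OF T] free_eval_tensor_left[OF T])

lemma scale_free_eval: "scale k (free_eval g u) = free_eval (\<lambda>i. scale k (g i)) u"
  by (simp add: free_eval_def scale_sum_right mult.commute)

lemma functional_free_eval_scale: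
  assumes "functional f"
  shows "scale (f (free_eval g u)) v = free_eval (\<lambda>i. scale (f (g i)) v) u"
  by (simp add: linear_apply_free_eval[OF assms] scale_sum_left) (simp add: free_eval_def)

text \<open>The three composition laws contract two factors of the iterated comultiplication
  \<open>\<Sum>\<^sub>i a\<^sub>i \<otimes> b\<^sub>i \<otimes> e\<^sub>i\<close>. Contracting \<open>a\<^sub>i\<close> with \<open>f\<close> and \<open>b\<^sub>i\<close> with \<open>g\<close>, one bracketing applies
  \<open>act_left f\<close> and then \<open>act_left g\<close>; the other applies to the left factor of \<open>\<delta> c\<close> a single
  functional, the convolution product of \<open>f\<close> and \<open>g\<close>, which is \<open>\<lambda>x. g (act_left f x)\<close>.\<close>

lemma act_left_act_left:
  assumes f: "functional f" and g: "functional g"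
  shows "act_left g (act_left f c) = act_left (\<lambda>x. g (act_left f x)) c"
proof -
  let ?T = "\<lambda>(x, y, z). scale (f x * g y) z"
  interpret G: Vector_Spaces.linear scale scale "act_left g" by (rule linear_act[OF g])
  have "act_left (\<lambda>x. g (act_left f x)) c
    = free_eval (\<lambda>(x, z). free_eval (\<lambda>(a, b). ?T (a, b, z)) (coset_rep (\<delta> x))) (coset_rep (\<delta> c))"
    using g by (simp add: act_left_def contract_left_def functional_free_eval_scale[OF g]
        functional_iff case_prod_unfold)
  also have "\<dots> = free_eval (\<lambda>(x, z). free_eval (\<lambda>(a, b). ?T (x, a, b)) (coset_rep (\<delta> z))) (coset_rep (\<delta> c))"
    by (rule coassoc_eval) (use f g in \<open>auto simp: endomorphism_iff functional_iff algebra_simps\<close>)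
  also have "\<dots> = free_eval (\<lambda>(x, z). scale (f x) (act_left g z)) (coset_rep (\<delta> c))"
    by (simp add: act_left_def contract_left_def scale_free_eval case_prod_unfold)
  also have "\<dots> = act_left g (act_left f c)"
    unfolding act_left_def[of f] contract_left_def linear_apply_free_eval[OF linear_act(1)[OF g]]
    by (simp add: free_eval_def case_prod_unfold G.scale)
  finally show ?thesis by simp
qed

text \<open>The mirror image: the last two factors are contracted.\<close>

lemma act_right_act_right:
  assumes f: "functional f" and g: "functional g"
  shows "act_right g (act_right f c) = act_right (\<lambda>x. g (act_right f x)) c"
proof -
  let ?T = "\<lambda>(x, y, z). scale (g y * f z) x"
  interpret G: Vector_Spaces.linear scale scale "act_right g" by (rule linear_act[OF g])
  have "act_right (\<lambda>x. g (act_right f x)) c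
    = free_eval (\<lambda>(x, z). free_eval (\<lambda>(a, b). ?T (x, a, b)) (coset_rep (\<delta> z))) (coset_rep (\<delta> c))"
    using g by (simp add: act_right_def contract_right_def functional_free_eval_scale[OF g]
        functional_iff case_prod_unfold mult.commute)
  also have "\<dots> = free_eval (\<lambda>(x, z). free_eval (\<lambda>(a, b). ?T (a, b, z)) (coset_rep (\<delta> x))) (coset_rep (\<delta> c))"
    by (rule coassoc_eval[symmetric])
       (use f g in \<open>auto simp: endomorphism_iff functional_iff algebra_simps\<close>)
  also have "\<dots> = free_eval (\<lambda>(x, z). scale (f z) (act_right g x)) (coset_rep (\<delta> c))"
    by (simp add: act_right_def contract_right_def scale_free_eval case_prod_unfold mult.commute)
  also have "\<dots> = act_right g (act_right f c)"
    unfolding act_right_def[of f] contract_right_def linear_apply_free_eval[OF linear_act(2)[OF g]]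
    by (simp add: free_eval_def case_prod_unfold G.scale)
  finally show ?thesis by simp
qed

text \<open>Contracting the two outer factors leaves the middle one, and the two bracketings differ only in
  which end is removed first.\<close>

lemma act_right_act_left:
  assumes f: "functional f" and g: "functional g"
  shows "act_right g (act_left f c) = act_left f (act_right g c)"
proof -
  let ?T = "\<lambda>(x, y, z). scale (f x * g z) y"
  interpret F: Vector_Spaces.linear scale scale "act_left f" by (rule linear_act[OF f])
  interpret G: Vector_Spaces.linear scale scale "act_right g" by (rule linear_act[OF g])
  have "act_left f (act_right g c) = free_eval (\<lambda>(x, z). scale (g z) (act_left f x)) (coset_rep (\<delta> c))"
    unfolding act_right_def[of g] contract_right_def linear_apply_free_eval[OF linear_act(1)[OF f]]
    by (simp add: free_eval_def case_prod_unfold F.scale)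
  also have "\<dots> = free_eval (\<lambda>(x, z). free_eval (\<lambda>(a, b). ?T (a, b, z)) (coset_rep (\<delta> x))) (coset_rep (\<delta> c))"
    by (simp add: act_left_def contract_left_def scale_free_eval case_prod_unfold mult.commute)
  also have "\<dots> = free_eval (\<lambda>(x, z). free_eval (\<lambda>(a, b). ?T (x, a, b)) (coset_rep (\<delta> z))) (coset_rep (\<delta> c))"
    by (rule coassoc_eval) (use f g in \<open>auto simp: endomorphism_iff functional_iff algebra_simps\<close>)
  also have "\<dots> = free_eval (\<lambda>(x, z). scale (f x) (act_right g z)) (coset_rep (\<delta> c))"
    by (simp add: act_right_def contract_right_def scale_free_eval case_prod_unfold)
  also have "\<dots> = act_right g (act_left f c)"
    unfolding act_left_def[of f] contract_left_def linear_apply_free_eval[OF linear_act(2)[OF g]]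
    by (simp add: free_eval_def case_prod_unfold G.scale)
  finally show ?thesis by simp
qed


section \<open>The subcoalgebra generated by an element\<close>

definition act_orbit :: "'c \<Rightarrow> 'c set" where
  "act_orbit c = insert c ({act_left f c | f. functional f} \<union> {act_right g c | g. functional g}
     \<union> {act_left f (act_right g c) | f g. functional f \<and> functional g})"

text \<open>The composition laws let any further operator be absorbed: a left operator merges with an
  outer left operator if there is one, while a right operator first commutes past a left one and
  then merges with the right operator below it, if any.\<close>

lemma act_orbit_closed:
  assumes h: "functional h" and x: "x \<in> act_orbit c"
  shows "act_left h x \<in> act_orbit c" "act_right h x \<in> act_orbit c"
proof -
  have comp: "functional (\<lambda>x. g (act_left f x))" "functional (\<lambda>x. g (act_right f x))"
    if "functional f" "functional g" for f g
    using that linear_act[OF that(1)] by (auto simp: functional_iff endomorphism_iff)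
  have orbit: "c \<in> act_orbit c"
    "functional f \<Longrightarrow> act_left f c \<in> act_orbit c"
    "functional g \<Longrightarrow> act_right g c \<in> act_orbit c"
    "functional f \<Longrightarrow> functional g \<Longrightarrow> act_left f (act_right g c) \<in> act_orbit c" for f g
    unfolding act_orbit_def by blast+
  from x consider "x = c" | f where "functional f" "x = act_left f c"
    | g where "functional g" "x = act_right g c"
    | f g where "functional f" "functional g" "x = act_left f (act_right g c)"
    unfolding act_orbit_def by blast
  hence "act_left h x \<in> act_orbit c \<and> act_right h x \<in> act_orbit c"
    by cases (simp_all add: h comp orbit act_left_act_left act_right_act_left act_right_act_right)
  thus "act_left h x \<in> act_orbit c" "act_right h x \<in> act_orbit c" by simp_all
qed

lemma span_act_orbit_generated: "is_subcoalgebra_generated_by (span (act_orbit c)) c"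
proof -
  have "act_left h x \<in> span (act_orbit c) \<and> act_right h x \<in> span (act_orbit c)"
    if h: "functional h" and x: "x \<in> span (act_orbit c)" for h x
  proof -
    interpret L: Vector_Spaces.linear scale scale "act_left h" by (rule linear_act[OF h])
    interpret R: Vector_Spaces.linear scale scale "act_right h" by (rule linear_act[OF h])
    have "act_left h ` act_orbit c \<subseteq> act_orbit c" "act_right h ` act_orbit c \<subseteq> act_orbit c"
      using act_orbit_closed[OF h] by blast+
    hence "act_left h ` span (act_orbit c) \<subseteq> span (act_orbit c)"
      "act_right h ` span (act_orbit c) \<subseteq> span (act_orbit c)"
      unfolding L.span_image[symmetric] R.span_image[symmetric] by (simp_all add: span_mono)
    with x show ?thesis by blast
  qed
  moreover have "span (act_orbit c) \<subseteq> E" if "subcoalgebra E" "c \<in> E" for E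
    by (rule span_minimal) (use that in \<open>auto simp: act_orbit_def subcoalgebra_iff_act\<close>)
  moreover have "c \<in> span (act_orbit c)"
    by (rule span_base) (simp add: act_orbit_def)
  ultimately show ?thesis
    unfolding is_subcoalgebra_generated_by_def by (auto simp: subcoalgebra_iff_act)
qed

text \<open>The vectors occurring in the chosen representative of \<open>\<delta> x\<close>; unlike their contractions, they
  depend on that choice, but no functional enters, which makes the bound below uniform in \<open>f\<close>.\<close>

definition comult_factors :: "'c \<Rightarrow> 'c set" where
  "comult_factors x = fst ` Poly_Mapping.keys (coset_rep (\<delta> x)) \<union> snd ` Poly_Mapping.keys (coset_rep (\<delta> x))"

lemma finite_comult_factors: "finite (comult_factors x)"
  by (simp add: comult_factors_def)

lemma act_in_span_comult_factors:
  "act_left f x \<in> span (comult_factors x)" "act_right f x \<in> span (comult_factors x)"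
proof -
  have "fst i \<in> span (comult_factors x)" "snd i \<in> span (comult_factors x)"
    if "i \<in> Poly_Mapping.keys (coset_rep (\<delta> x))" for i
    using that by (simp_all add: span_base comult_factors_def)
  thus "act_left f x \<in> span (comult_factors x)" "act_right f x \<in> span (comult_factors x)"
    by (simp_all add: act_left_def contract_left_def act_right_def contract_right_def
        free_eval_def case_prod_unfold span_sum span_scale)
qed

lemma finite_dimensional_span_act_orbit: "finite_dimensional (span (act_orbit c))"
proof -
  \<comment> \<open>Two layers of factors: \<open>act_right g c\<close> is a combination of factors \<open>x\<close> of \<open>\<delta> c\<close>, and
    \<open>act_left f\<close> sends each such \<open>x\<close> to a combination of factors of \<open>\<delta> x\<close>.\<close>
  define S where "S = insert c (comult_factors c \<union> (\<Union>x\<in>comult_factors c. comult_factors x))"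
  have S: "v \<in> span S" if "v \<in> span (comult_factors c)" for v
    using that span_mono[of "comult_factors c" S] by (auto simp: S_def)
  have "act_left f (act_right g c) \<in> span S" if f: "functional f" for f g
  proof -
    interpret L: Vector_Spaces.linear scale scale "act_left f" by (rule linear_act[OF f])
    have "act_left f x \<in> span S" if "x \<in> comult_factors c" for x
      using act_in_span_comult_factors(1)[of f x] span_mono[of "comult_factors x" S] that
      by (auto simp: S_def)
    hence "span (act_left f ` comult_factors c) \<subseteq> span S"
      by (intro span_minimal) auto
    thus ?thesis
      using act_in_span_comult_factors(2)[of g c] L.span_image[of "comult_factors c"] by blast
  qed
  moreover have "c \<in> span S" by (rule span_base) (simp add: S_def)
  ultimately have "span (act_orbit c) \<subseteq> span S"
    using S act_in_span_comult_factors[of _ c]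
    by (intro span_minimal) (auto simp: act_orbit_def)
  moreover have "finite S" by (simp add: S_def finite_comult_factors)
  ultimately show ?thesis by (intro finite_dimensional_subspace_of_finite_span) auto
qed

end

theorem proposition2p6:
  fixes scale :: "'k::field \<Rightarrow> 'c::ab_group_add \<Rightarrow> 'c"
    and \<delta> :: "'c \<Rightarrow> ('c \<times> 'c \<Rightarrow>\<^sub>0 'k) set"
    and c :: 'c
  assumes "coalgebra scale \<delta>"
  shows "\<exists>D. coalgebra.is_subcoalgebra_generated_by scale \<delta> D c
             \<and> vector_space.finite_dimensional scale D"
proof -
  interpret coalgebra scale \<delta> by fact
  show ?thesis using span_act_orbit_generated finite_dimensional_span_act_orbit by blast
qed

end
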